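(* Let $G=(V,E)$ be a path or a cyclic graph and let $p\ge 0$ be an integer. If $G$ has no maximal independent set of cardinality $p$, then $$\tilde H_{p-q-1}(\mathrm{Ind}(G-N[U]))\cong 0$$ holds for all $q>0$ and all independent sets $U\subset V$ with $|U|=q$.
   Context: Graphs are finite and simple. A path is a path graph $P_n$ on $n\geq 1$ vertices; a cyclic graph is a cycle $C_n$ on $n\ge 3$ vertices. A set $I\subset V$ is independent if no two of its elements are adjacent; it is a maximal independent set if it is not properly contained in another independent set. The independence complex $\mathrm{Ind}(G)$ is the simplicial complex on vertex set $V$ whose simplices are the independent sets of $G$. For $v\in V$, $N[v]$ is the set consisting of $v$ and all vertices adjacent to $v$; for $U\subset V$, $N[U]=\bigcup_{v\in U}N[v]$. For $W\subset V$, $G-W$ is the induced subgraph of $G$ on $V\setminus W$. $\tilde H$ denotes reduced simplicial homology with integer coefficients, i.e. the homology of the augmented simplicial chain complex, which includes the empty simplex in degree $-1$. For the empty graph, the augmented chain complex of $\mathrm{Ind}(\emptyset)$ is $\mathbb{Z}$ concentrated in degree $-1$, so $\tilde H_{-1}(\mathrm{Ind}(\emptyset))\cong\mathbb{Z}$; homology in degrees below $-1$ is zero. *)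

theory Defs
  imports "HOL-Algebra.Free_Abelian_Groups" "HOL-Algebra.Elementary_Groups"
begin

section \<open>Finite simple graphs\<close>

type_synonym 'a ugraph = "'a set \<times> 'a set set"

abbreviation verts :: "'a ugraph \<Rightarrow> 'a set" where "verts \<equiv> fst"
abbreviation edges :: "'a ugraph \<Rightarrow> 'a set set" where "edges \<equiv> snd"

definition simple_graph :: "'a ugraph \<Rightarrow> bool" where
  "simple_graph G \<longleftrightarrow> finite (verts G) \<and>
     (\<forall>e \<in> edges G. \<exists>u \<in> verts G. \<exists>v \<in> verts G. u \<noteq> v \<and> e = {u, v})"

definition path_graph :: "'a ugraph \<Rightarrow> bool" where
  "path_graph G \<longleftrightarrow> (\<exists>vs. length vs \<ge> 1 \<and> distinct vs \<and> verts G = set vs \<and>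
     edges G = {{vs ! i, vs ! Suc i} | i. Suc i < length vs})"

definition cycle_graph :: "'a ugraph \<Rightarrow> bool" where
  "cycle_graph G \<longleftrightarrow> (\<exists>vs. length vs \<ge> 3 \<and> distinct vs \<and> verts G = set vs \<and>
     edges G = {{vs ! i, vs ! (Suc i mod length vs)} | i. i < length vs})"

lemma path_graph_imp_simple_graph: "path_graph G \<Longrightarrow> simple_graph G"
proof -
  assume "path_graph G"
  then obtain vs where vs: "distinct vs" "verts G = set vs"
      "edges G = {{vs ! i, vs ! Suc i} | i. Suc i < length vs}"
    unfolding path_graph_def by blast
  have "vs ! i \<in> set vs \<and> vs ! Suc i \<in> set vs \<and> vs ! i \<noteq> vs ! Suc i"
    if "Suc i < length vs" for i
    using that vs(1) by (simp add: nth_eq_iff_index_eq)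
  then show ?thesis
    unfolding simple_graph_def vs(2,3) by blast
qed

lemma cycle_graph_imp_simple_graph: "cycle_graph G \<Longrightarrow> simple_graph G"
proof -
  assume "cycle_graph G"
  then obtain vs where vs: "length vs \<ge> 3" "distinct vs" "verts G = set vs"
      "edges G = {{vs ! i, vs ! (Suc i mod length vs)} | i. i < length vs}"
    unfolding cycle_graph_def by blast
  have "vs ! i \<in> set vs \<and> vs ! (Suc i mod length vs) \<in> set vs
      \<and> vs ! i \<noteq> vs ! (Suc i mod length vs)" if i: "i < length vs" for i
  proof -
    have lt: "Suc i mod length vs < length vs"
      using i by (intro mod_less_divisor) linarith
    have "i \<noteq> Suc i mod length vs"
      using i vs(1) by (cases "Suc i = length vs") auto
    then show ?thesis
      using i lt vs(2) by (simp add: nth_eq_iff_index_eq)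
  qed
  then show ?thesis
    unfolding simple_graph_def vs(3,4) by blast
qed

definition closed_nbhd :: "'a ugraph \<Rightarrow> 'a \<Rightarrow> 'a set" where
  "closed_nbhd G v = insert v {w \<in> verts G. {v, w} \<in> edges G}"

definition closed_nbhd_set :: "'a ugraph \<Rightarrow> 'a set \<Rightarrow> 'a set" where
  "closed_nbhd_set G U = (\<Union>v \<in> U. closed_nbhd G v)"

definition del_verts :: "'a ugraph \<Rightarrow> 'a set \<Rightarrow> 'a ugraph" where
  "del_verts G W = (verts G - W, {e \<in> edges G. e \<subseteq> verts G - W})"

definition independent_set :: "'a ugraph \<Rightarrow> 'a set \<Rightarrow> bool" where
  "independent_set G I \<longleftrightarrow> I \<subseteq> verts G \<and> (\<forall>u \<in> I. \<forall>v \<in> I. {u, v} \<notin> edges G)"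

definition maximal_independent_set :: "'a ugraph \<Rightarrow> 'a set \<Rightarrow> bool" where
  "maximal_independent_set G I \<longleftrightarrow>
     independent_set G I \<and> \<not> (\<exists>J. independent_set G J \<and> I \<subset> J)"

section \<open>Reduced simplicial homology with integer coefficients\<close>

text \<open>
  A simplicial complex is the set of its simplices, the empty simplex included. As usual, a
  linear order \<open>r\<close> of the vertices orients the simplices: \<open>\<sigma> = {v\<^sub>0 < \<dots> < v\<^sub>k}\<close> represents
  \<open>[v\<^sub>0, \<dots>, v\<^sub>k]\<close>. Degrees are integers; the empty simplex spans the chains of degree \<open>-1\<close>, and
  there are no simplices in degrees below \<open>-1\<close>.
\<close>

definition simplicial_chain_group :: "'a set set \<Rightarrow> int \<Rightarrow> ('a set \<Rightarrow>\<^sub>0 int) monoid" where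
  "simplicial_chain_group K k =
     free_Abelian_group {\<sigma> \<in> K. finite \<sigma> \<and> int (card \<sigma>) = k + 1}"

text \<open>
  The exponent is the position \<open>i\<close> of \<open>v = v\<^sub>i\<close> in \<open>\<sigma>\<close>, so this is the usual alternating sum of
  faces. On a vertex it is the augmentation, and it vanishes on the empty simplex.
\<close>

definition simplicial_boundary ::
    "('a \<times> 'a) set \<Rightarrow> ('a set \<Rightarrow>\<^sub>0 int) \<Rightarrow> ('a set \<Rightarrow>\<^sub>0 int)" where
  "simplicial_boundary r = frag_extend (\<lambda>\<sigma>.
     \<Sum>v \<in> \<sigma>. frag_cmul ((-1) ^ card {u \<in> \<sigma>. u \<noteq> v \<and> (u, v) \<in> r}) (frag_of (\<sigma> - {v})))"

definition simplicial_cycles ::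
    "('a \<times> 'a) set \<Rightarrow> 'a set set \<Rightarrow> int \<Rightarrow> ('a set \<Rightarrow>\<^sub>0 int) set" where
  "simplicial_cycles r K k =
     {c \<in> carrier (simplicial_chain_group K k). simplicial_boundary r c = 0}"

definition simplicial_boundaries ::
    "('a \<times> 'a) set \<Rightarrow> 'a set set \<Rightarrow> int \<Rightarrow> ('a set \<Rightarrow>\<^sub>0 int) set" where
  "simplicial_boundaries r K k =
     simplicial_boundary r ` carrier (simplicial_chain_group K (k + 1))"

definition reduced_homology_group ::
    "('a \<times> 'a) set \<Rightarrow> 'a set set \<Rightarrow> int \<Rightarrow> ('a set \<Rightarrow>\<^sub>0 int) set monoid" where
  "reduced_homology_group r K k =
     subgroup_generated (simplicial_chain_group K k) (simplicial_cycles r K k)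
       Mod simplicial_boundaries r K k"

definition independence_complex :: "'a ugraph \<Rightarrow> 'a set set" where
  "independence_complex G = {I. independent_set G I}"

end

theory Submission
  imports Defs
begin

text \<open>
  If \<open>G\<close> has no maximal independent set of size \<open>p\<close>, then \<open>F = G - N[U]\<close> has none of size
  \<open>p - q\<close>, because a maximal independent set of \<open>F\<close> together with \<open>U\<close> is maximal in \<open>G\<close>.
  As \<open>U\<close> is nonempty, every nonempty set of vertices of \<open>F\<close> contains a vertex with at most one
  neighbour in that set. For any such graph \<open>F\<close>, the absence of maximal independent sets of size
  \<open>m\<close> forces the reduced homology of \<open>Ind F\<close> in degree \<open>m - 1\<close> to vanish: if \<open>x\<close> is isolated,
  \<open>Ind F\<close> is a cone with apex \<open>x\<close>; if \<open>w\<close> is the only neighbour of \<open>x\<close>, then \<open>Ind (F - w)\<close> is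
  a cone with apex \<open>x\<close>, so the homology of \<open>Ind F\<close> in degree \<open>m - 1\<close> is that of the link
  \<open>Ind (F - N[w])\<close> of \<open>w\<close> in degree \<open>m - 2\<close>, and induction applies to \<open>F - N[w]\<close> and \<open>m - 1\<close>.
\<close>

section \<open>Cones on simplicial chains\<close>

text \<open>The vertex \<open>v\<close> is left out of the count, so the sign is the same for
  \<sigma>, \<open>insert v \<sigma>\<close> and \<open>\<sigma> - {v}\<close>. One sign thus serves
  for adding and for removing \<open>v\<close>.\<close>

definition vertex_sign :: "('a \<times> 'a) set \<Rightarrow> 'a \<Rightarrow> 'a set \<Rightarrow> int" where
  "vertex_sign r v \<sigma> = (-1) ^ card {u \<in> \<sigma>. u \<noteq> v \<and> (u, v) \<in> r}"

text \<open>The oriented join w * \<sigma> = [w, v0, ..., vk]; the sign is the cost of moving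
  \<open>w\<close> from the front to its place in the order. It is meant for chains whose simplices
  avoid \<open>w\<close>.\<close>

definition cone_chain :: "('a \<times> 'a) set \<Rightarrow> 'a \<Rightarrow> ('a set \<Rightarrow>\<^sub>0 int) \<Rightarrow> ('a set \<Rightarrow>\<^sub>0 int)" where
  "cone_chain r w = frag_extend (\<lambda>\<sigma>. frag_cmul (vertex_sign r w \<sigma>) (frag_of (insert w \<sigma>)))"

text \<open>Left inverse of the cone on chains avoiding \<open>w\<close>. Every chain c is then w *
  b plus a chain avoiding \<open>w\<close>, where b = \<open>link_chain r w c\<close>.\<close>

definition link_chain :: "('a \<times> 'a) set \<Rightarrow> 'a \<Rightarrow> ('a set \<Rightarrow>\<^sub>0 int) \<Rightarrow> ('a set \<Rightarrow>\<^sub>0 int)" where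
  "link_chain r w = frag_extend (\<lambda>\<sigma>. if w \<in> \<sigma>
     then frag_cmul (vertex_sign r w \<sigma>) (frag_of (\<sigma> - {w})) else 0)"

section \<open>Signs and linearity\<close>

lemma vertex_sign_square [simp]: "vertex_sign r v \<sigma> * vertex_sign r v \<sigma> = 1"
  by (simp add: vertex_sign_def flip: power_add)

lemma vertex_sign_insert_self [simp]: "vertex_sign r w (insert w \<sigma>) = vertex_sign r w \<sigma>"
  unfolding vertex_sign_def by (rule arg_cong [where f = "\<lambda>A. (-1) ^ card A"]) auto

lemma vertex_sign_remove_self [simp]: "vertex_sign r w (\<sigma> - {w}) = vertex_sign r w \<sigma>"
  unfolding vertex_sign_def by (rule arg_cong [where f = "\<lambda>A. (-1) ^ card A"]) auto

lemma vertex_sign_insert: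
  assumes "finite \<sigma>" "v \<notin> \<sigma>" "v \<noteq> w"
  shows "vertex_sign r w (insert v \<sigma>) = (if (v, w) \<in> r then - 1 else 1) * vertex_sign r w \<sigma>"
proof -
  have "{u \<in> insert v \<sigma>. u \<noteq> w \<and> (u, w) \<in> r} =
      (if (v, w) \<in> r then insert v {u \<in> \<sigma>. u \<noteq> w \<and> (u, w) \<in> r}
       else {u \<in> \<sigma>. u \<noteq> w \<and> (u, w) \<in> r})"
    using assms by auto
  then show ?thesis
    using assms by (simp add: vertex_sign_def)
qed

lemma simplicial_boundary_of:
  "simplicial_boundary r (frag_of \<sigma>) =
     (\<Sum>v \<in> \<sigma>. frag_cmul (vertex_sign r v \<sigma>) (frag_of (\<sigma> - {v})))"
  by (simp add: simplicial_boundary_def vertex_sign_def)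

lemma cone_chain_of:
  "cone_chain r w (frag_of \<sigma>) = frag_cmul (vertex_sign r w \<sigma>) (frag_of (insert w \<sigma>))"
  by (simp add: cone_chain_def)

lemma simplicial_boundary_0 [simp]: "simplicial_boundary r 0 = 0"
  and simplicial_boundary_add:
    "simplicial_boundary r (c + d) = simplicial_boundary r c + simplicial_boundary r d"
  and simplicial_boundary_diff:
    "simplicial_boundary r (c - d) = simplicial_boundary r c - simplicial_boundary r d"
  and simplicial_boundary_minus: "simplicial_boundary r (- c) = - simplicial_boundary r c"
  and simplicial_boundary_cmul:
    "simplicial_boundary r (frag_cmul n c) = frag_cmul n (simplicial_boundary r c)"
  by (simp_all add: simplicial_boundary_def frag_extend_add frag_extend_diff frag_extend_minus
      frag_extend_cmul)

lemma cone_chain_0 [simp]: "cone_chain r w 0 = 0"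
  and cone_chain_diff: "cone_chain r w (c - d) = cone_chain r w c - cone_chain r w d"
  by (simp_all add: cone_chain_def frag_extend_diff)

lemma link_chain_0 [simp]: "link_chain r w 0 = 0"
  and link_chain_add: "link_chain r w (c + d) = link_chain r w c + link_chain r w d"
  and link_chain_diff: "link_chain r w (c - d) = link_chain r w c - link_chain r w d"
  by (simp_all add: link_chain_def frag_extend_add frag_extend_diff)

section \<open>Supports of chains and splitting at a vertex\<close>

lemma keys_simplicial_boundary:
  "Poly_Mapping.keys (simplicial_boundary r c) \<subseteq> {\<sigma> - {v} |\<sigma> v. \<sigma> \<in> Poly_Mapping.keys c \<and> v \<in> \<sigma>}"
  unfolding simplicial_boundary_def
  by (rule order_trans [OF keys_frag_extend], rule UN_least, rule order_trans [OF keys_sum], auto) blast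

lemma notin_simplicial_boundary:
  assumes "Poly_Mapping.keys c \<subseteq> {\<sigma>. w \<notin> \<sigma>}" "\<tau> \<in> Poly_Mapping.keys (simplicial_boundary r c)"
  shows "w \<notin> \<tau>"
  using subsetD [OF keys_simplicial_boundary assms(2)] assms(1) by blast

lemma keys_cone_chain:
  "Poly_Mapping.keys (cone_chain r w c) \<subseteq> insert w ` Poly_Mapping.keys c"
  unfolding cone_chain_def by (rule order_trans [OF keys_frag_extend]) (auto split: if_splits)

lemma keys_link_chain:
  "Poly_Mapping.keys (link_chain r w c) \<subseteq> {\<sigma> - {w} |\<sigma>. \<sigma> \<in> Poly_Mapping.keys c \<and> w \<in> \<sigma>}"
  unfolding link_chain_def by (rule order_trans [OF keys_frag_extend]) (auto split: if_splits)

lemma link_chain_eq_0: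
  assumes "\<And>\<sigma>. \<sigma> \<in> Poly_Mapping.keys c \<Longrightarrow> w \<notin> \<sigma>"
  shows "link_chain r w c = 0"
  using assms unfolding link_chain_def by (intro frag_extend_eq_0) auto

lemma link_chain_cone_chain:
  assumes "\<And>\<sigma>. \<sigma> \<in> Poly_Mapping.keys c \<Longrightarrow> w \<notin> \<sigma>"
  shows "link_chain r w (cone_chain r w c) = c"
proof -
  have "Poly_Mapping.keys c \<subseteq> {\<sigma>. w \<notin> \<sigma>}" using assms by auto
  then show ?thesis
  proof (induction rule: frag_induction)
    case (one \<sigma>)
    then show ?case
      by (simp add: cone_chain_of link_chain_def frag_extend_cmul)
  qed (simp_all add: cone_chain_diff link_chain_diff)
qed

text \<open>By linearity it is enough to look at one simplex: if it contains \<open>w\<close>,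
  removing and re-adding \<open>w\<close> returns it with a squared sign; otherwise its link part is
  0.\<close>

lemma keys_diff_cone_link:
  "Poly_Mapping.keys (c - cone_chain r w (link_chain r w c)) \<subseteq> {\<sigma> \<in> Poly_Mapping.keys c. w \<notin> \<sigma>}"
proof -
  have *: "frag_of \<sigma> - cone_chain r w (link_chain r w (frag_of \<sigma>)) =
      (if w \<in> \<sigma> then 0 else frag_of \<sigma>)" for \<sigma>
    by (simp add: link_chain_def cone_chain_def frag_extend_cmul insert_absorb)
  have "c - cone_chain r w (link_chain r w c) =
      frag_extend (\<lambda>\<sigma>. if w \<in> \<sigma> then 0 else frag_of \<sigma>) c"
    using subset_UNIV [of "Poly_Mapping.keys c"]
  proof (induction rule: frag_induction)
    case (diff a b)
    then show ?case
      by (simp add: cone_chain_diff link_chain_diff frag_extend_diff algebra_simps)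
  qed (simp_all add: *)
  then show ?thesis
    using keys_frag_extend [of "\<lambda>\<sigma>. if w \<in> \<sigma> then 0 else frag_of \<sigma>" c]
    by (fastforce split: if_splits)
qed

text \<open>The face opposite \<open>w\<close> carries a squared sign, so it is \<sigma> itself.
  Every other face is the join of \<open>w\<close> with a face of \<sigma>, with reversed sign
  because \<open>w\<close> stands in front of all vertices in the join.\<close>

lemma simplicial_boundary_cone_simplex:
  assumes r: "linear_order_on V r" and \<sigma>: "finite \<sigma>" "\<sigma> \<subseteq> V" and w: "w \<in> V" "w \<notin> \<sigma>"
  shows "simplicial_boundary r (cone_chain r w (frag_of \<sigma>)) =
    frag_of \<sigma> - cone_chain r w (simplicial_boundary r (frag_of \<sigma>))"
proof -
  \<comment> \<open>By totality and antisymmetry exactly one of \<open>(v, w)\<close> and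
    \<open>(w, v)\<close> is in \<open>r\<close>, so exactly one of the two signs changes when the
    other vertex is inserted.\<close>
  have sign: "vertex_sign r w \<sigma> * vertex_sign r v (insert w \<sigma>) =
      - (vertex_sign r v \<sigma> * vertex_sign r w (\<sigma> - {v}))" if v: "v \<in> \<sigma>" for v
  proof -
    have "v \<noteq> w" "v \<in> V" using v w \<sigma> by auto
    then have "(v, w) \<in> r \<longleftrightarrow> (w, v) \<notin> r"
      using r w unfolding linear_order_on_def partial_order_on_def total_on_def antisym_def by metis
    moreover have "vertex_sign r w \<sigma> = (if (v, w) \<in> r then - 1 else 1) * vertex_sign r w (\<sigma> - {v})"
      using vertex_sign_insert [of "\<sigma> - {v}" v w r] v \<open>v \<noteq> w\<close> \<sigma> by (simp add: insert_absorb)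
    moreover have "vertex_sign r v (insert w \<sigma>) = (if (w, v) \<in> r then - 1 else 1) * vertex_sign r v \<sigma>"
      using vertex_sign_insert [of \<sigma> w v r] \<open>v \<noteq> w\<close> \<sigma> w by simp
    ultimately show ?thesis by auto
  qed
  have "simplicial_boundary r (cone_chain r w (frag_of \<sigma>)) = frag_of \<sigma> +
      (\<Sum>v\<in>\<sigma>. frag_cmul (vertex_sign r w \<sigma> * vertex_sign r v (insert w \<sigma>)) (frag_of (insert w \<sigma> - {v})))"
    using \<sigma> w by (simp add: cone_chain_of simplicial_boundary_cmul simplicial_boundary_of
        frag_cmul_distrib2 frag_cmul_sum)
  also have "(\<Sum>v\<in>\<sigma>. frag_cmul (vertex_sign r w \<sigma> * vertex_sign r v (insert w \<sigma>))
        (frag_of (insert w \<sigma> - {v}))) =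
      (\<Sum>v\<in>\<sigma>. - frag_cmul (vertex_sign r v \<sigma> * vertex_sign r w (\<sigma> - {v}))
        (frag_of (insert w (\<sigma> - {v}))))"
    using w sign by (intro sum.cong) (auto simp: insert_Diff_if)
  also have "\<dots> = - cone_chain r w (simplicial_boundary r (frag_of \<sigma>))"
    using \<sigma> by (simp add: simplicial_boundary_of cone_chain_def frag_extend_sum frag_extend_cmul
        sum_negf o_def del: minus_frag_cmul)
  finally show ?thesis by simp
qed

lemma simplicial_boundary_cone:
  assumes r: "linear_order_on V r" and w: "w \<in> V"
    and c: "Poly_Mapping.keys c \<subseteq> {\<sigma>. finite \<sigma> \<and> \<sigma> \<subseteq> V \<and> w \<notin> \<sigma>}"
  shows "simplicial_boundary r (cone_chain r w c) = c - cone_chain r w (simplicial_boundary r c)"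
  using c
proof (induction rule: frag_induction)
  case (one \<sigma>)
  then show ?case using simplicial_boundary_cone_simplex [OF r] w by blast
qed (simp_all add: cone_chain_diff simplicial_boundary_diff)

text \<open>Build the simplex vertex by vertex: up to sign \<open>insert w \<sigma>\<close> is w *
  \<sigma>, and two uses of the cone formula give dd(w * \<sigma>) = d\<sigma> - (d\<sigma> - w *
  dd\<sigma>), which is 0 by induction.\<close>

lemma simplicial_boundary_boundary:
  assumes r: "linear_order_on V r" and c: "Poly_Mapping.keys c \<subseteq> {\<sigma>. finite \<sigma> \<and> \<sigma> \<subseteq> V}"
  shows "simplicial_boundary r (simplicial_boundary r c) = 0"
proof -
  have "simplicial_boundary r (simplicial_boundary r (frag_of \<sigma>)) = 0"
    if "finite \<sigma>" "\<sigma> \<subseteq> V" for \<sigma>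
    using that
  proof (induction rule: finite_induct)
    case empty
    then show ?case by (simp add: simplicial_boundary_of)
  next
    case (insert w \<sigma>)
    let ?d = "simplicial_boundary r"
    have keys: "Poly_Mapping.keys (?d (frag_of \<sigma>)) \<subseteq> {\<sigma>. finite \<sigma> \<and> \<sigma> \<subseteq> V \<and> w \<notin> \<sigma>}"
      by (rule order_trans [OF keys_simplicial_boundary]) (use insert in auto)
    have "frag_of (insert w \<sigma>) = frag_cmul (vertex_sign r w \<sigma>) (cone_chain r w (frag_of \<sigma>))"
      by (simp add: cone_chain_of)
    moreover have "?d (?d (cone_chain r w (frag_of \<sigma>))) = 0"
      using insert simplicial_boundary_cone_simplex [OF r, of \<sigma> w]
        simplicial_boundary_cone [OF r _ keys]
      by (simp add: simplicial_boundary_diff)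
    ultimately show ?case by (simp add: simplicial_boundary_cmul)
  qed
  note simplex = this
  show ?thesis
    using c by (induction rule: frag_induction) (auto simp: simplex simplicial_boundary_diff)
qed

section \<open>Vanishing of homology\<close>

text \<open>Vanishing is kept at the level of chains; the quotient group enters only in
  \<open>trivial_reduced_homology_group\<close>. Here \<open>K\<close> may be any family of
  sets.\<close>

definition acyclic_in_degree :: "('a \<times> 'a) set \<Rightarrow> 'a set set \<Rightarrow> int \<Rightarrow> bool" where
  "acyclic_in_degree r K k \<longleftrightarrow> simplicial_cycles r K k \<subseteq> simplicial_boundaries r K k"

section \<open>From chains to the homology group\<close>

lemma carrier_simplicial_chain_group_iff [simp]:
  "c \<in> carrier (simplicial_chain_group K k) \<longleftrightarrow>
     Poly_Mapping.keys c \<subseteq> {\<sigma> \<in> K. finite \<sigma> \<and> int (card \<sigma>) = k + 1}"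
  unfolding simplicial_chain_group_def by simp

lemma simplicial_boundaries_iff:
  "b \<in> simplicial_boundaries r K k \<longleftrightarrow>
     (\<exists>c. Poly_Mapping.keys c \<subseteq> {\<sigma> \<in> K. finite \<sigma> \<and> int (card \<sigma>) = k + 1 + 1} \<and>
       b = simplicial_boundary r c)"
  unfolding simplicial_boundaries_def image_iff Bex_def carrier_simplicial_chain_group_iff ..

lemma acyclic_in_degree_iff:
  "acyclic_in_degree r K k \<longleftrightarrow>
     (\<forall>z. Poly_Mapping.keys z \<subseteq> {\<sigma> \<in> K. finite \<sigma> \<and> int (card \<sigma>) = k + 1} \<longrightarrow>
       simplicial_boundary r z = 0 \<longrightarrow>
       (\<exists>c. Poly_Mapping.keys c \<subseteq> {\<sigma> \<in> K. finite \<sigma> \<and> int (card \<sigma>) = k + 1 + 1} \<and>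
         z = simplicial_boundary r c))"
  unfolding acyclic_in_degree_def simplicial_cycles_def subset_eq mem_Collect_eq
    carrier_simplicial_chain_group_iff [unfolded subset_eq] simplicial_boundaries_iff [unfolded subset_eq]
  by blast

lemma acyclic_in_degreeE:
  assumes "acyclic_in_degree r K k"
    and "Poly_Mapping.keys z \<subseteq> {\<sigma> \<in> K. finite \<sigma> \<and> int (card \<sigma>) = k + 1}"
    and "simplicial_boundary r z = 0"
  obtains c where "Poly_Mapping.keys c \<subseteq> {\<sigma> \<in> K. finite \<sigma> \<and> int (card \<sigma>) = k + 1 + 1}"
    and "z = simplicial_boundary r c"
  using assms unfolding acyclic_in_degree_iff by blast

text \<open>The only coset of the whole group is the group itself.\<close>

lemma (in group) trivial_group_self_quotient: "trivial_group (G Mod carrier G)"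
proof -
  have "group (G Mod carrier G)"
    using normal.factorgroup_is_group [OF normal_self] .
  moreover have "carrier (G Mod carrier G) = {carrier G}"
    using one_closed by (auto simp: FactGroup_def RCOSETS_def coset_join2 subgroup_self)
  ultimately show ?thesis
    by (simp add: trivial_group_def FactGroup_def)
qed

lemma simplicial_boundaries_subset_cycles:
  assumes "linear_order_on V r" "K \<subseteq> Pow V" "\<And>\<sigma> v. \<sigma> \<in> K \<Longrightarrow> \<sigma> - {v} \<in> K"
  shows "simplicial_boundaries r K k \<subseteq> simplicial_cycles r K k"
proof
  fix b assume "b \<in> simplicial_boundaries r K k"
  then obtain c where c: "Poly_Mapping.keys c \<subseteq> {\<sigma> \<in> K. finite \<sigma> \<and> int (card \<sigma>) = k + 1 + 1}"
      and b: "b = simplicial_boundary r c"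
    unfolding simplicial_boundaries_iff by blast
  have "simplicial_boundary r b = 0"
    unfolding b by (rule simplicial_boundary_boundary [OF assms(1)]) (use c assms(2) in blast)
  moreover have "Poly_Mapping.keys b \<subseteq> {\<sigma> \<in> K. finite \<sigma> \<and> int (card \<sigma>) = k + 1}"
    unfolding b
  proof
    fix \<tau> assume "\<tau> \<in> Poly_Mapping.keys (simplicial_boundary r c)"
    then obtain \<sigma> v where \<sigma>: "\<sigma> \<in> Poly_Mapping.keys c" "v \<in> \<sigma>" "\<tau> = \<sigma> - {v}"
      using subsetD [OF keys_simplicial_boundary] by blast
    then have K: "\<sigma> \<in> K" "finite \<sigma>" "int (card \<sigma>) = k + 1 + 1"
      using c by auto
    have "card \<sigma> = Suc (card \<tau>)"
      unfolding \<sigma>(3) by (rule card.remove [OF K(2) \<sigma>(2)])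
    moreover have "\<tau> \<in> K" "finite \<tau>"
      using assms(3) [OF K(1), of v] K(2) \<sigma>(3) by simp_all
    ultimately show "\<tau> \<in> {\<sigma> \<in> K. finite \<sigma> \<and> int (card \<sigma>) = k + 1}"
      using K(3) by simp
  qed
  ultimately show "b \<in> simplicial_cycles r K k"
    unfolding simplicial_cycles_def by simp
qed

text \<open>A kernel is a subgroup. This ensures that \<open>subgroup_generated\<close> adds nothing
  to the cycles in the homology group.\<close>

lemma subgroup_simplicial_cycles:
  "subgroup (simplicial_cycles r K k) (simplicial_chain_group K k)"
proof -
  have "group (simplicial_chain_group K k)"
    by (simp add: simplicial_chain_group_def)
  then show ?thesis
  proof (rule group.subgroupI)
    have "0 \<in> simplicial_cycles r K k"
      unfolding simplicial_cycles_def by simp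
    then show "simplicial_cycles r K k \<noteq> {}" by auto
  next
    fix a b assume ab: "a \<in> simplicial_cycles r K k" "b \<in> simplicial_cycles r K k"
    show "a \<otimes>\<^bsub>simplicial_chain_group K k\<^esub> b \<in> simplicial_cycles r K k"
      using ab keys_add [of a b] unfolding simplicial_cycles_def
      by (auto simp: simplicial_chain_group_def simplicial_boundary_add)
    show "inv\<^bsub>simplicial_chain_group K k\<^esub> a \<in> simplicial_cycles r K k"
      using ab unfolding simplicial_cycles_def
      by (auto simp: simplicial_chain_group_def simplicial_boundary_minus)
  qed (auto simp: simplicial_cycles_def)
qed

text \<open>Cycles and boundaries coincide, so the group is the quotient of the cycle group by
  itself.\<close>

lemma trivial_reduced_homology_group:
  assumes "linear_order_on V r" "K \<subseteq> Pow V" "\<And>\<sigma> v. \<sigma> \<in> K \<Longrightarrow> \<sigma> - {v} \<in> K"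
    and "acyclic_in_degree r K k"
  shows "trivial_group (reduced_homology_group r K k)"
proof -
  let ?Z = "subgroup_generated (simplicial_chain_group K k) (simplicial_cycles r K k)"
  have "simplicial_boundaries r K k = simplicial_cycles r K k"
    using simplicial_boundaries_subset_cycles [OF assms(1-3)] assms(4)
    unfolding acyclic_in_degree_def by blast
  moreover have "carrier ?Z = simplicial_cycles r K k"
    by (rule subgroup.carrier_subgroup_generated_subgroup [OF subgroup_simplicial_cycles])
  moreover have "group ?Z"
    by (rule group.group_subgroup_generated) (simp add: simplicial_chain_group_def)
  ultimately show ?thesis
    using group.trivial_group_self_quotient [of ?Z] unfolding reduced_homology_group_def by simp
qed

section \<open>Criteria for vanishing\<close>

lemma acyclic_in_degree_no_simplices:
  assumes "\<And>\<sigma>. \<sigma> \<in> K \<Longrightarrow> finite \<sigma> \<Longrightarrow> int (card \<sigma>) \<noteq> k + 1"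
  shows "acyclic_in_degree r K k"
proof -
  \<comment> \<open>The only chain in this degree is then 0, the boundary of 0.\<close>
  have no: "{\<sigma> \<in> K. finite \<sigma> \<and> int (card \<sigma>) = k + 1} = {}"
    using assms by auto
  show ?thesis
    unfolding acyclic_in_degree_iff no by (auto intro!: exI [of _ 0])
qed

text \<open>Write z = a + w * b with a and b avoiding \<open>w\<close>. Then dz = 0 reads da + b - w
  * db = 0; only the last term can involve simplices containing \<open>w\<close>, so db = 0 and
  hence da = -b.\<close>

lemma cycle_decomposition:
  assumes r: "linear_order_on V r" and w: "w \<in> V"
    and z: "Poly_Mapping.keys z \<subseteq> {\<sigma>. finite \<sigma> \<and> \<sigma> \<subseteq> V}" "simplicial_boundary r z = 0"
  defines "b \<equiv> link_chain r w z" and "a \<equiv> z - cone_chain r w (link_chain r w z)"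
  shows "simplicial_boundary r b = 0" and "simplicial_boundary r a = - b"
proof -
  let ?d = "simplicial_boundary r"
  have kb: "Poly_Mapping.keys b \<subseteq> {\<sigma>. finite \<sigma> \<and> \<sigma> \<subseteq> V \<and> w \<notin> \<sigma>}"
    unfolding b_def by (rule order_trans [OF keys_link_chain]) (use z(1) in blast)
  have ka: "Poly_Mapping.keys a \<subseteq> {\<sigma>. w \<notin> \<sigma>}"
    unfolding a_def by (rule order_trans [OF keys_diff_cone_link]) blast
  have "z = a + cone_chain r w b" by (simp add: a_def b_def)
  then have eq: "?d a + (b - cone_chain r w (?d b)) = 0"
    using z(2) simplicial_boundary_cone [OF r w kb] by (simp add: simplicial_boundary_add)
  have kb': "Poly_Mapping.keys b \<subseteq> {\<sigma>. w \<notin> \<sigma>}"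
    using kb by blast
  \<comment> \<open>Applying \<open>link_chain r w\<close> to the equation isolates db: it kills the
    chains avoiding \<open>w\<close> and undoes the cone.\<close>
  have "link_chain r w (?d a) = 0" "link_chain r w b = 0"
    using notin_simplicial_boundary [OF ka] kb' by (blast intro: link_chain_eq_0)+
  moreover have "link_chain r w (cone_chain r w (?d b)) = ?d b"
    using notin_simplicial_boundary [OF kb'] by (rule link_chain_cone_chain)
  ultimately show db: "?d b = 0"
    using arg_cong [OF eq, of "link_chain r w"] by (simp add: link_chain_add link_chain_diff)
  show "?d a = - b"
    using eq by (simp add: db eq_neg_iff_add_eq_0)
qed

text \<open>Coning z itself would fail on simplices that already contain \<open>v\<close>. With z =
  a + v * b and da = -b, the chain v * a works: d(v * a) = a - v * da = a + v * b = z.\<close>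

lemma acyclic_in_degree_cone:
  assumes r: "linear_order_on V r" and K: "K \<subseteq> Pow V" and v: "v \<in> V"
    and cone: "\<And>\<sigma>. \<sigma> \<in> K \<Longrightarrow> insert v \<sigma> \<in> K"
  shows "acyclic_in_degree r K k"
  unfolding acyclic_in_degree_iff
proof (intro allI impI)
  fix z assume z: "Poly_Mapping.keys z \<subseteq> {\<sigma> \<in> K. finite \<sigma> \<and> int (card \<sigma>) = k + 1}"
      "simplicial_boundary r z = 0"
  then have zV: "Poly_Mapping.keys z \<subseteq> {\<sigma>. finite \<sigma> \<and> \<sigma> \<subseteq> V}"
    using K by auto
  define a where "a = z - cone_chain r v (link_chain r v z)"
  have ka: "Poly_Mapping.keys a \<subseteq> {\<sigma> \<in> Poly_Mapping.keys z. v \<notin> \<sigma>}"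
    unfolding a_def by (rule keys_diff_cone_link)
  have "simplicial_boundary r a = - link_chain r v z"
    using cycle_decomposition(2) [OF r v zV z(2)] by (simp add: a_def)
  then have "cone_chain r v (simplicial_boundary r a) = a - z"
    using cone_chain_diff [of r v 0 "link_chain r v z"] by (simp add: a_def)
  moreover have "simplicial_boundary r (cone_chain r v a) = a - cone_chain r v (simplicial_boundary r a)"
    by (rule simplicial_boundary_cone [OF r v]) (use ka zV in auto)
  ultimately have "z = simplicial_boundary r (cone_chain r v a)"
    by simp
  moreover have "Poly_Mapping.keys (cone_chain r v a) \<subseteq> {\<sigma> \<in> K. finite \<sigma> \<and> int (card \<sigma>) = k + 1 + 1}"
    using keys_cone_chain [of r v a] ka z(1) cone by fastforce
  ultimately show "\<exists>c. Poly_Mapping.keys c \<subseteq> {\<sigma> \<in> K. finite \<sigma> \<and> int (card \<sigma>) = k + 1 + 1} \<and>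
      z = simplicial_boundary r c"
    by blast
qed

text \<open>Stated for a set: the induction takes the link of a vertex, the extension of maximal
  independent sets that of a whole independent set.\<close>

definition link_complex :: "'a set set \<Rightarrow> 'a set \<Rightarrow> 'a set set" where
  "link_complex K U = {\<sigma>. \<sigma> \<inter> U = {} \<and> \<sigma> \<union> U \<in> K}"

text \<open>Exactness in the middle of H_k(deletion) -> H_k(K) -> H_{k-1}(link), done on chains.
  Split z = a + w * b. The cycle b bounds some c in the link, so a + c is a cycle of the deletion
  and bounds some e there, and d(e - w * c) = (a + c) - (c - w * b) = z.\<close>

lemma acyclic_in_degree_link_deletion:
  assumes r: "linear_order_on V r" and K: "K \<subseteq> Pow V" "\<And>\<sigma> v. \<sigma> \<in> K \<Longrightarrow> \<sigma> - {v} \<in> K"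
    and w: "w \<in> V"
    and del: "acyclic_in_degree r {\<sigma> \<in> K. w \<notin> \<sigma>} k"
    and link: "acyclic_in_degree r (link_complex K {w}) (k - 1)"
  shows "acyclic_in_degree r K k"
  unfolding acyclic_in_degree_iff
proof (intro allI impI)
  let ?d = "simplicial_boundary r"
  fix z assume z: "Poly_Mapping.keys z \<subseteq> {\<sigma> \<in> K. finite \<sigma> \<and> int (card \<sigma>) = k + 1}" "?d z = 0"
  then have zV: "Poly_Mapping.keys z \<subseteq> {\<sigma>. finite \<sigma> \<and> \<sigma> \<subseteq> V}"
    using K(1) by auto
  define b where "b = link_chain r w z"
  define a where "a = z - cone_chain r w b"
  have ka: "Poly_Mapping.keys a \<subseteq> {\<sigma> \<in> Poly_Mapping.keys z. w \<notin> \<sigma>}"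
    unfolding a_def b_def by (rule keys_diff_cone_link)
  have db: "?d b = 0" and da: "?d a = - b"
    using cycle_decomposition [OF r w zV z(2)] by (simp_all add: a_def b_def)
  have kb: "Poly_Mapping.keys b \<subseteq> {\<sigma> \<in> link_complex K {w}. finite \<sigma> \<and> int (card \<sigma>) = k - 1 + 1}"
  proof
    fix \<tau> assume "\<tau> \<in> Poly_Mapping.keys b"
    from subsetD [OF keys_link_chain this [unfolded b_def]]
    obtain \<sigma> where \<sigma>: "\<sigma> \<in> Poly_Mapping.keys z" "w \<in> \<sigma>" "\<tau> = \<sigma> - {w}"
      by blast
    have z\<sigma>: "\<sigma> \<in> K" "finite \<sigma>" "int (card \<sigma>) = k + 1"
      using subsetD [OF z(1) \<sigma>(1)] by simp_all
    have "card \<sigma> = Suc (card \<tau>)"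
      unfolding \<sigma>(3) by (rule card.remove [OF z\<sigma>(2) \<sigma>(2)])
    moreover have "\<tau> \<in> link_complex K {w}" "finite \<tau>"
      using z\<sigma> \<sigma>(2,3) by (simp_all add: link_complex_def insert_absorb)
    ultimately show "\<tau> \<in> {\<sigma> \<in> link_complex K {w}. finite \<sigma> \<and> int (card \<sigma>) = k - 1 + 1}"
      using z\<sigma>(3) by simp
  qed
  obtain c where
    kc: "Poly_Mapping.keys c \<subseteq> {\<sigma> \<in> link_complex K {w}. finite \<sigma> \<and> int (card \<sigma>) = k + 1}"
    and c: "b = ?d c"
    by (rule acyclic_in_degreeE [OF link kb db, unfolded diff_add_cancel])
  \<comment> \<open>The link of \<open>w\<close> lies in the deletion of \<open>w\<close>, so a and
    c can be added there.\<close>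
  have del_c: "Poly_Mapping.keys c \<subseteq> {\<sigma> \<in> {\<sigma> \<in> K. w \<notin> \<sigma>}. finite \<sigma> \<and> int (card \<sigma>) = k + 1}"
  proof
    fix \<sigma> assume "\<sigma> \<in> Poly_Mapping.keys c"
    then show "\<sigma> \<in> {\<sigma> \<in> {\<sigma> \<in> K. w \<notin> \<sigma>}. finite \<sigma> \<and> int (card \<sigma>) = k + 1}"
      using subsetD [OF kc, of \<sigma>] K(2) [of "insert w \<sigma>" w] by (simp add: link_complex_def)
  qed
  have cV: "Poly_Mapping.keys c \<subseteq> {\<sigma>. finite \<sigma> \<and> \<sigma> \<subseteq> V \<and> w \<notin> \<sigma>}"
    using del_c K(1) by auto
  have dwc: "?d (cone_chain r w c) = c - cone_chain r w b"
    unfolding c by (rule simplicial_boundary_cone [OF r w cV])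
  have dac: "?d (a + c) = 0"
    using da c by (simp add: simplicial_boundary_add)
  have "Poly_Mapping.keys (a + c) \<subseteq> {\<sigma> \<in> {\<sigma> \<in> K. w \<notin> \<sigma>}. finite \<sigma> \<and> int (card \<sigma>) = k + 1}"
    by (rule order_trans [OF Poly_Mapping.keys_add], rule Un_least [OF _ del_c]) (use ka z(1) in blast)
  then obtain e where
    "Poly_Mapping.keys e \<subseteq> {\<sigma> \<in> {\<sigma> \<in> K. w \<notin> \<sigma>}. finite \<sigma> \<and> int (card \<sigma>) = k + 1 + 1}"
    and e: "a + c = ?d e"
    by (rule acyclic_in_degreeE [OF del _ dac])
  then have ke: "Poly_Mapping.keys e \<subseteq> {\<sigma> \<in> K. finite \<sigma> \<and> int (card \<sigma>) = k + 1 + 1}"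
    by blast
  have "Poly_Mapping.keys (cone_chain r w c) \<subseteq> {\<sigma> \<in> K. finite \<sigma> \<and> int (card \<sigma>) = k + 1 + 1}"
  proof (rule order_trans [OF keys_cone_chain], rule image_subsetI)
    fix \<sigma> assume "\<sigma> \<in> Poly_Mapping.keys c"
    from subsetD [OF kc this] show "insert w \<sigma> \<in> {\<sigma> \<in> K. finite \<sigma> \<and> int (card \<sigma>) = k + 1 + 1}"
      by (simp add: link_complex_def)
  qed
  then have "Poly_Mapping.keys (e - cone_chain r w c) \<subseteq> {\<sigma> \<in> K. finite \<sigma> \<and> int (card \<sigma>) = k + 1 + 1}"
    using keys_diff [of e "cone_chain r w c"] ke by blast
  moreover have "z = ?d (e - cone_chain r w c)"
    by (simp only: simplicial_boundary_diff dwc flip: e) (simp add: a_def)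
  ultimately show "\<exists>c. Poly_Mapping.keys c \<subseteq> {\<sigma> \<in> K. finite \<sigma> \<and> int (card \<sigma>) = k + 1 + 1} \<and>
      z = simplicial_boundary r c"
    by blast
qed

section \<open>Independence complexes\<close>

lemma simple_graph_edgeD:
  assumes "simple_graph G" "{u, v} \<in> edges G"
  shows "u \<in> verts G" "v \<in> verts G" "u \<noteq> v"
  using assms unfolding simple_graph_def by (auto simp: doubleton_eq_iff)

lemma simple_graph_del_verts: "simple_graph G \<Longrightarrow> simple_graph (del_verts G W)"
  unfolding simple_graph_def del_verts_def by fastforce

lemma independence_complex_subset: "independence_complex G \<subseteq> Pow (verts G)"
  by (auto simp: independence_complex_def independent_set_def)

lemma independence_complex_remove:
  "\<sigma> \<in> independence_complex G \<Longrightarrow> \<sigma> - {v} \<in> independence_complex G"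
  by (auto simp: independence_complex_def independent_set_def)

lemma independence_complex_del_vert:
  "independence_complex (del_verts G {w}) = {\<sigma> \<in> independence_complex G. w \<notin> \<sigma>}"
  by (auto simp: independence_complex_def independent_set_def del_verts_def)

text \<open>Disjointness from \<open>U\<close> and absence of edges between \<sigma> and
  \<open>U\<close> together say that \<sigma> avoids N[U]; the edges among the remaining vertices
  are unchanged by the deletion.\<close>

lemma link_independence_complex:
  assumes G: "simple_graph G" and U: "independent_set G U"
  shows "link_complex (independence_complex G) U =
    independence_complex (del_verts G (closed_nbhd_set G U))"
proof -
  have "independent_set G (\<sigma> \<union> U) \<and> \<sigma> \<inter> U = {} \<longleftrightarrow>
      independent_set (del_verts G (closed_nbhd_set G U)) \<sigma>" for \<sigma>
  proof
    assume "independent_set G (\<sigma> \<union> U) \<and> \<sigma> \<inter> U = {}"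
    then show "independent_set (del_verts G (closed_nbhd_set G U)) \<sigma>"
      unfolding independent_set_def del_verts_def closed_nbhd_set_def closed_nbhd_def by auto
  next
    assume "independent_set (del_verts G (closed_nbhd_set G U)) \<sigma>"
    then have \<sigma>: "\<sigma> \<subseteq> verts G - closed_nbhd_set G U"
        "\<And>u v. u \<in> \<sigma> \<Longrightarrow> v \<in> \<sigma> \<Longrightarrow> {u, v} \<notin> edges G"
      unfolding independent_set_def del_verts_def by auto
    have "{u, v} \<notin> edges G" "{v, u} \<notin> edges G" "v \<noteq> u" if "u \<in> U" "v \<in> \<sigma>" for u v
      using \<sigma>(1) that unfolding closed_nbhd_set_def closed_nbhd_def
      by (auto simp: insert_commute)
    then show "independent_set G (\<sigma> \<union> U) \<and> \<sigma> \<inter> U = {}"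
      using \<sigma> U unfolding independent_set_def by blast
  qed
  then show ?thesis
    unfolding link_complex_def independence_complex_def by blast
qed

text \<open>If an independent \<open>J\<close> properly contained \<open>I \<union> U\<close>, then
  \<open>J - U\<close> would be independent in the smaller graph, by the description of the link,
  and would properly contain \<open>I\<close>. Disjointness is recorded for counting.\<close>

lemma maximal_independent_set_Un:
  assumes G: "simple_graph G" and U: "independent_set G U"
    and I: "maximal_independent_set (del_verts G (closed_nbhd_set G U)) I"
  shows "maximal_independent_set G (I \<union> U)" and "I \<inter> U = {}"
proof -
  let ?F = "del_verts G (closed_nbhd_set G U)"
  have link: "independent_set ?F \<sigma> \<longleftrightarrow> \<sigma> \<inter> U = {} \<and> independent_set G (\<sigma> \<union> U)" for \<sigma>
    using link_independence_complex [OF G U]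
    unfolding link_complex_def independence_complex_def by blast
  have IU: "I \<inter> U = {}" "independent_set G (I \<union> U)"
    using I link unfolding maximal_independent_set_def by blast+
  have "\<not> I \<union> U \<subset> J" if J: "independent_set G J" for J
  proof
    assume sub: "I \<union> U \<subset> J"
    then have "independent_set ?F (J - U)"
      using J link [of "J - U"] by (auto simp: Un_absorb2)
    moreover have "I \<subset> J - U"
      using sub IU(1) by auto
    ultimately show False
      using I unfolding maximal_independent_set_def by blast
  qed
  with IU show "maximal_independent_set G (I \<union> U)" "I \<inter> U = {}"
    unfolding maximal_independent_set_def by blast+
qed

text \<open>For finite simple graphs these are exactly the forests. The quantifier over
  \<open>W\<close> makes the property pass to induced subgraphs, as the induction requires.\<close>

definition one_degenerate :: "'a ugraph \<Rightarrow> bool" where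
  "one_degenerate G \<longleftrightarrow> (\<forall>W \<subseteq> verts G. W \<noteq> {} \<longrightarrow>
     (\<exists>x \<in> W. \<forall>y \<in> W. \<forall>z \<in> W. {x, y} \<in> edges G \<longrightarrow> {x, z} \<in> edges G \<longrightarrow> y = z))"

lemma one_degenerate_del_verts:
  assumes "one_degenerate G"
  shows "one_degenerate (del_verts G W)"
  unfolding one_degenerate_def
proof (intro allI impI)
  fix X assume X: "X \<subseteq> verts (del_verts G W)" "X \<noteq> {}"
  then have "X \<subseteq> verts G" by (auto simp: del_verts_def)
  with assms X(2) obtain x where "x \<in> X"
      "\<forall>y \<in> X. \<forall>z \<in> X. {x, y} \<in> edges G \<longrightarrow> {x, z} \<in> edges G \<longrightarrow> y = z"
    unfolding one_degenerate_def by blast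
  moreover have "edges (del_verts G W) \<subseteq> edges G" by (auto simp: del_verts_def)
  ultimately show "\<exists>x \<in> X. \<forall>y \<in> X. \<forall>z \<in> X. {x, y} \<in> edges (del_verts G W) \<longrightarrow>
      {x, z} \<in> edges (del_verts G W) \<longrightarrow> y = z"
    by (intro bexI [of _ x]) auto
qed

text \<open>In \<open>W\<close>, the vertex with the least number can only be adjacent to the one
  numbered one higher. Numbers may have gaps, so the criterion suits graphs with deleted
  vertices.\<close>

lemma one_degenerate_numbering:
  fixes f :: "'a \<Rightarrow> nat"
  assumes inj: "inj_on f (verts G)"
    and edge: "\<And>x y. {x, y} \<in> edges G \<Longrightarrow> x \<in> verts G \<Longrightarrow> y \<in> verts G \<Longrightarrow> f x < f y \<Longrightarrow> f y = Suc (f x)"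
    and loop: "\<And>x. {x} \<notin> edges G"
  shows "one_degenerate G"
  unfolding one_degenerate_def
proof (intro allI impI)
  fix W assume W: "W \<subseteq> verts G" "W \<noteq> {}"
  then obtain x where x: "x \<in> W" "\<And>y. y \<in> W \<Longrightarrow> f x \<le> f y"
    using ex_has_least_nat [of "\<lambda>x. x \<in> W" _ f] by (metis ex_in_conv)
  have "f y = Suc (f x)" if "y \<in> W" "{x, y} \<in> edges G" for y
  proof -
    have "y \<noteq> x" using that loop by auto
    then have "f x \<noteq> f y" using inj W x that by (auto dest: inj_onD)
    then have "f x < f y" using x(2) [OF that(1)] by simp
    then show ?thesis using edge [OF that(2)] W(1) x(1) that(1) by blast
  qed
  then have "y = z" if "y \<in> W" "z \<in> W" "{x, y} \<in> edges G" "{x, z} \<in> edges G" for y z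
    using that inj W by (metis inj_onD subsetD)
  then show "\<exists>x \<in> W. \<forall>y \<in> W. \<forall>z \<in> W. {x, y} \<in> edges G \<longrightarrow> {x, z} \<in> edges G \<longrightarrow> y = z"
    using x(1) by blast
qed

lemma path_graph_one_degenerate:
  assumes "path_graph G"
  shows "one_degenerate G"
proof -
  obtain vs where vs: "distinct vs" "verts G = set vs"
      "edges G = {{vs ! i, vs ! Suc i} | i. Suc i < length vs}"
    using assms unfolding path_graph_def by blast
  define f where "f = the_inv_into {..<length vs} ((!) vs)"
  have bij: "bij_betw ((!) vs) {..<length vs} (set vs)"
    using vs(1) by (simp add: bij_betw_nth)
  then have f: "f (vs ! i) = i" if "i < length vs" for i
    using that unfolding f_def by (intro the_inv_into_f_f) (auto simp: bij_betw_def)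
  show ?thesis
  proof (rule one_degenerate_numbering [of f])
    show "inj_on f (verts G)"
      using bij_betw_the_inv_into [OF bij] by (simp add: f_def vs(2) bij_betw_def)
    show "{x} \<notin> edges G" for x
      using simple_graph_edgeD(3) [OF path_graph_imp_simple_graph [OF assms], of x x] by auto
    fix x y assume "{x, y} \<in> edges G" "f x < f y"
    then obtain i where "Suc i < length vs" "{x, y} = {vs ! i, vs ! Suc i}"
      unfolding vs(3) by auto
    with \<open>f x < f y\<close> show "f y = Suc (f x)"
      using f by (auto simp: doubleton_eq_iff)
  qed
qed

text \<open>Deleting \<open>u\<close> cuts the cycle open, so the remaining vertices can be numbered
  along a path; deleting more of \<open>W\<close> only leaves gaps.\<close>

lemma cycle_graph_del_vert_one_degenerate:
  assumes "cycle_graph G" "u \<in> verts G" "u \<in> W"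
  shows "one_degenerate (del_verts G W)"
proof -
  obtain vs where vs: "length vs \<ge> 3" "distinct vs" "verts G = set vs"
      "edges G = {{vs ! i, vs ! (Suc i mod length vs)} | i. i < length vs}"
    using assms(1) unfolding cycle_graph_def by blast
  let ?n = "length vs"
  obtain j where j: "j < ?n" "u = vs ! j"
    using assms(2) vs(3) by (auto simp: in_set_conv_nth)
  define p where "p = the_inv_into {..<?n} ((!) vs)"
  \<comment> \<open>The cyclic distance from \<open>u\<close>, that is \<open>p x - j\<close> modulo
    the length, written without negative differences; \<open>u\<close> gets 0.\<close>
  define f where "f x = (if j \<le> p x then p x - j else p x + ?n - j)" for x
  have bij: "bij_betw ((!) vs) {..<?n} (set vs)"
    using vs(2) by (simp add: bij_betw_nth)
  then have p: "p (vs ! i) = i" if "i < ?n" for i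
    using that unfolding p_def by (intro the_inv_into_f_f) (auto simp: bij_betw_def)
  have bijp: "bij_betw p (set vs) {..<?n}"
    using bij_betw_the_inv_into [OF bij] by (simp add: p_def)
  show ?thesis
  proof (rule one_degenerate_numbering [of f])
    show "inj_on f (verts (del_verts G W))"
    proof (rule inj_onI)
      fix x y assume xy: "x \<in> verts (del_verts G W)" "y \<in> verts (del_verts G W)" "f x = f y"
      then have "x \<in> set vs" "y \<in> set vs" by (auto simp: del_verts_def vs(3))
      moreover from this have "p x < ?n" "p y < ?n"
        using bijp by (auto simp: bij_betw_def)
      moreover from this have "p x = p y"
        using xy(3) j(1) by (auto simp: f_def split: if_splits)
      ultimately show "x = y"
        using bijp by (auto simp: bij_betw_def dest: inj_onD)
    qed
    show "{x} \<notin> edges (del_verts G W)" for x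
      using simple_graph_edgeD(3) [OF cycle_graph_imp_simple_graph [OF assms(1)], of x x]
      by (auto simp: del_verts_def)
    fix x y assume e: "{x, y} \<in> edges (del_verts G W)" "f x < f y"
    then obtain i where i: "i < ?n" "{x, y} = {vs ! i, vs ! (Suc i mod ?n)}"
      unfolding del_verts_def vs(4) by auto
    have *: "x \<noteq> u" "y \<noteq> u"
      using e assms(3) by (auto simp: del_verts_def)
    \<comment> \<open>One step along the cycle raises the cyclic distance by one unless it ends at
      \<open>u\<close>, which is deleted. In the wrap-around case this exclusion says
      \<open>j \<noteq> 0\<close>, otherwise \<open>j \<noteq> Suc i\<close>.\<close>
    have fS: "f (vs ! (Suc i mod ?n)) = Suc (f (vs ! i))"
    proof (cases "Suc i = ?n")
      case True
      then have "j \<noteq> 0" using i * j by (intro notI) (auto simp: doubleton_eq_iff)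
      moreover have "p (vs ! 0) = 0" using j(1) by (intro p) linarith
      ultimately show ?thesis
        using True j(1) p [of i] by (auto simp: f_def)
    next
      case False
      then have lt: "Suc i < ?n" using i by simp
      then have "j \<noteq> Suc i" using i * j by (auto simp: doubleton_eq_iff)
      then show ?thesis
        using lt j(1) p [of i] p [of "Suc i"] by (auto simp: f_def)
    qed
    from i(2) consider "x = vs ! i" "y = vs ! (Suc i mod ?n)" | "y = vs ! i" "x = vs ! (Suc i mod ?n)"
      by (auto simp: doubleton_eq_iff)
    then show "f y = Suc (f x)"
      using fS e(2) by cases auto
  qed
qed

text \<open>The order lives on a fixed \<open>V\<close> containing the vertices, so it stays the
  same while the graph shrinks; \<open>m\<close> varies in the induction because passing to a link
  lowers it by one.\<close>

theorem acyclic_independence_complex: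
  assumes "simple_graph G" "one_degenerate G" "linear_order_on V r" "verts G \<subseteq> V"
    and "\<not> (\<exists>I. maximal_independent_set G I \<and> card I = m)"
  shows "acyclic_in_degree r (independence_complex G) (int m - 1)"
  using assms
proof (induction "card (verts G)" arbitrary: G m rule: less_induct)
  case less
  note G = less.prems(1)
  have fin: "finite (verts G)" using G by (simp add: simple_graph_def)
  have KV: "independence_complex G \<subseteq> Pow V"
    using independence_complex_subset less.prems(4) by blast
  show ?case
  proof (cases "verts G = {}")
    case True
    \<comment> \<open>The empty set is maximal here, so \<open>m\<close> is nonzero, and the only
      simplex, the empty one, lies in degree -1 and not in degree \<open>int m - 1\<close>.\<close>
    then have "maximal_independent_set G {}"
      by (auto simp: maximal_independent_set_def independent_set_def)
    then have "m \<noteq> 0" using less.prems(5) by auto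
    then show ?thesis
      using True independence_complex_subset [of G] by (intro acyclic_in_degree_no_simplices) auto
  next
    case False
    then obtain x where x: "x \<in> verts G" and unique: "\<And>y z. y \<in> verts G \<Longrightarrow> z \<in> verts G \<Longrightarrow>
        {x, y} \<in> edges G \<Longrightarrow> {x, z} \<in> edges G \<Longrightarrow> y = z"
      using less.prems(2) unfolding one_degenerate_def by (meson order_refl)
    have xV: "x \<in> V" using x less.prems(4) by auto
    have no_loop: "{x, x} \<notin> edges G" using simple_graph_edgeD(3) [OF G, of x x] by auto
    show ?thesis
    proof (cases "\<exists>w. {x, w} \<in> edges G")
      case False
      then have "insert x \<sigma> \<in> independence_complex G" if "\<sigma> \<in> independence_complex G" for \<sigma>
        using that x by (auto simp: independence_complex_def independent_set_def insert_commute)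
      then show ?thesis
        by (rule acyclic_in_degree_cone [OF less.prems(3) KV xV])
    next
      case True
      then obtain w where w: "{x, w} \<in> edges G" by blast
      note wG = simple_graph_edgeD [OF G w]
      have only_w: "y = w" if "{x, y} \<in> edges G" for y
        using unique w that simple_graph_edgeD(2) [OF G] by blast
      have "insert x \<sigma> \<in> independence_complex (del_verts G {w})"
        if \<sigma>: "\<sigma> \<in> independence_complex (del_verts G {w})" for \<sigma>
      proof -
        have "{x, y} \<notin> edges G" "{y, x} \<notin> edges G" if "y \<in> \<sigma>" for y
          using \<sigma> that only_w [of y] unfolding independence_complex_del_vert
          by (auto simp: insert_commute)
        then show ?thesis
          using \<sigma> no_loop x wG(3) unfolding independence_complex_del_vert
          by (auto simp: independence_complex_def independent_set_def)
      qed
      then have del: "acyclic_in_degree r {\<sigma> \<in> independence_complex G. w \<notin> \<sigma>} (int m - 1)"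
        unfolding independence_complex_del_vert [symmetric]
        by (rule acyclic_in_degree_cone [OF less.prems(3) _ xV, rotated])
          (use KV in \<open>auto simp: independence_complex_del_vert\<close>)
      have Uw: "independent_set G {w}"
        using wG simple_graph_edgeD(3) [OF G, of w w] by (auto simp: independent_set_def)
      let ?F = "del_verts G (closed_nbhd_set G {w})"
      have "acyclic_in_degree r (independence_complex ?F) (int m - 1 - 1)"
      proof (cases m)
        case 0
        \<comment> \<open>The degree is -2 here, below that of the empty simplex.\<close>
        then show ?thesis by (intro acyclic_in_degree_no_simplices) auto
      next
        case (Suc l)
        have "card (verts ?F) < card (verts G)"
          using fin wG by (intro psubset_card_mono)
            (auto simp: del_verts_def closed_nbhd_set_def closed_nbhd_def)
        moreover have "\<not> (\<exists>I. maximal_independent_set ?F I \<and> card I = l)"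
        proof
          assume "\<exists>I. maximal_independent_set ?F I \<and> card I = l"
          then obtain I where I: "maximal_independent_set ?F I" "card I = l" by blast
          \<comment> \<open>Adding \<open>w\<close> turns a maximal independent set of size
            \<open>l\<close> into one of size \<open>m\<close> in \<open>G\<close>.\<close>
          note max = maximal_independent_set_Un [OF G Uw I(1)]
          have "finite I"
            using max(1) fin unfolding maximal_independent_set_def independent_set_def
            by (auto intro: finite_subset)
          then have "card (I \<union> {w}) = m"
            using max(2) I(2) Suc by simp
          with max(1) less.prems(5) show False by blast
        qed
        ultimately have "acyclic_in_degree r (independence_complex ?F) (int l - 1)"
          using less.prems(4) by (intro less.hyps simple_graph_del_verts one_degenerate_del_verts G
              less.prems(2,3)) (auto simp: del_verts_def)
        then show ?thesis using Suc by simp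
      qed
      then have link: "acyclic_in_degree r (link_complex (independence_complex G) {w}) (int m - 1 - 1)"
        by (simp add: link_independence_complex [OF G Uw])
      show ?thesis
        using acyclic_in_degree_link_deletion [OF less.prems(3) KV independence_complex_remove _ del link]
          wG(2) less.prems(4) by auto
    qed
  qed
qed

section \<open>Paths and cycles\<close>

theorem theorem1p2:
  fixes G :: "'a ugraph" and r :: "('a \<times> 'a) set" and p :: nat
  assumes "path_graph G \<or> cycle_graph G"
    and "linear_order_on (verts G) r"
    and "\<not> (\<exists>I. maximal_independent_set G I \<and> card I = p)"
  shows "\<forall>q > 0. \<forall>U. independent_set G U \<and> card U = q \<longrightarrow>
           trivial_group (reduced_homology_group r
             (independence_complex (del_verts G (closed_nbhd_set G U)))
             (int p - int q - 1))"
proof (intro allI impI)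
  fix q :: nat and U
  assume q: "q > 0" and "independent_set G U \<and> card U = q"
  then have U: "independent_set G U" "card U = q" by auto
  have G: "simple_graph G"
    using assms(1) path_graph_imp_simple_graph cycle_graph_imp_simple_graph by blast
  let ?F = "del_verts G (closed_nbhd_set G U)"
  have finG: "finite (verts G)" using G by (simp add: simple_graph_def)
  \<comment> \<open>Here \<open>q > 0\<close> enters: a vertex of \<open>U\<close> is deleted, which
    cuts a cycle open.\<close>
  obtain u where u: "u \<in> U" using q U(2) by fastforce
  then have "u \<in> verts G" "u \<in> closed_nbhd_set G U"
    using U(1) by (auto simp: independent_set_def closed_nbhd_set_def closed_nbhd_def)
  then have deg: "one_degenerate ?F"
    using assms(1) one_degenerate_del_verts [OF path_graph_one_degenerate]
      cycle_graph_del_vert_one_degenerate by metis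
  have FV: "verts ?F \<subseteq> verts G" by (auto simp: del_verts_def)
  have "acyclic_in_degree r (independence_complex ?F) (int p - int q - 1)"
  proof (cases "q \<le> p")
    case True
    \<comment> \<open>As \<open>q \<le> p\<close>, the subtraction of naturals is exact, and such a
      set joined with \<open>U\<close> would be maximal in \<open>G\<close> of size
      \<open>p\<close>.\<close>
    have "\<not> (\<exists>I. maximal_independent_set ?F I \<and> card I = p - q)"
    proof
      assume "\<exists>I. maximal_independent_set ?F I \<and> card I = p - q"
      then obtain I where I: "maximal_independent_set ?F I" "card I = p - q" by blast
      note max = maximal_independent_set_Un [OF G U(1) I(1)]
      have "finite (I \<union> U)"
        using max(1) finG unfolding maximal_independent_set_def independent_set_def
        by (auto intro: finite_subset)
      then have "card (I \<union> U) = p"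
        using max(2) I(2) U(2) True by (simp add: card_Un_disjoint)
      with max(1) assms(3) show False by blast
    qed
    from acyclic_independence_complex [OF simple_graph_del_verts [OF G] deg assms(2) FV this]
    show ?thesis using True by simp
  next
    case False
    \<comment> \<open>For \<open>q > p\<close> the degree is at most -2.\<close>
    then show ?thesis by (intro acyclic_in_degree_no_simplices) auto
  qed
  then show "trivial_group (reduced_homology_group r (independence_complex ?F) (int p - int q - 1))"
    using independence_complex_subset [of ?F] FV
    by (intro trivial_reduced_homology_group [OF assms(2)] independence_complex_remove) auto
qed

end
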